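(* Let $(\mathcal A,\mathcal A_0)$ be a metatangible pair. Then every element $c\in\mathcal A$, of height $m_c$, has a uniform presentation, meaning that there exists $c_{\mathcal T}\in\mathcal T$ such that one of the following holds. (i) The pair $(\mathcal A,\mathcal A_0)$ is of the first kind, and $c=m_c\,c_{\mathcal T}$. (ii) The pair $(\mathcal A,\mathcal A_0)$ is of the second kind, and either (a) $c=0$ and $m_c=0$; or (b) $c=c_{\mathcal T}\in\mathcal T$ and $m_c=1$; or (c) $c=c_{\mathcal T}^\circ$ and $m_c=2$. Moreover, in case (i), for some $m_0\ge 0$, $\mathcal A_0=\{m_c c_{\mathcal T} : m_c\ge m_0 \text{ or } m_c \text{ is even}\}$; and in case (ii), $\mathcal A=\{0\}\cup\mathcal T\cup\mathcal T^\circ$ and $\mathcal A_0=\mathcal T_0^\circ$.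
   Context: Let $\mathcal T$ be a set with a distinguished element $1$. A left $\mathcal T$-module is a commutative additive semigroup $(\mathcal A,+,0)$ with zero element and a left action of $\mathcal T$ satisfying $a0=0$, $a(b_1+b_2)=ab_1+ab_2$, $1b=b$; right modules are analogous; a $\mathcal T$-bimodule is both, with $(a_1b)a_2=a_1(ba_2)$. Put $\mathcal T_0=\mathcal T\cup\{0\}$ ($0\notin\mathcal T$). $\mathcal A$ is weakly admissible if $\mathcal T_0\subseteq\mathcal A$ and the left and right actions of each $a\in\mathcal T$ on $1\in\mathcal A$ give $a$; it is admissible if moreover $\mathcal T_0$ spans $(\mathcal A,+)$, i.e. every element is a finite sum of elements of $\mathcal T_0$. A pair $(\mathcal A,\mathcal A_0)$ is a $\mathcal T$-bimodule $\mathcal A$ with a sub-bimodule $\mathcal A_0$; it is (weakly) admissible if $\mathcal A$ is and $\mathcal A_0\cap\mathcal T_0=\{0\}$. Standing assumptions: all pairs are weakly admissible; for $a\in\mathcal T$, $b\in\mathcal A$, if $ab\in\mathcal A_0$ or $ba\in\mathcal A_0$ then $b\in\mathcal A_0$; and for $a\in\mathcal T$, $b_1,b_2\in\mathcal A$, $ab_1=ab_2$ or $b_1a=b_2a$ implies $b_1=b_2$. First kind: $1+1\in\mathcal A_0$. Second kind: $a+a\notin\mathcal A_0$ for all $a\in\mathcal T$. Weak Property N: there is $1^\dag\in\mathcal T$ with $1+1^\dag\in\mathcal A_0$, $1^\dag\mathcal T\subseteq\mathcal T$, and $1^\dag b=b1^\dag$ for all $b\in\mathcal A$. Fix such $1^\dag$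 and put $b^\dag=b1^\dag$, $b^\circ=b+b^\dag$. Property N: weak Property N holds and $a_1+a_2=a_1^\circ$ whenever $a_1,a_2\in\mathcal T$ and $a_1+a_2\in\mathcal A_0$. $\mathcal T^\circ=\{a^\circ:a\in\mathcal T\}$ and $\mathcal T_0^\circ=\mathcal T^\circ\cup\{0\}$. The pair is metatangible if it is admissible, satisfies Property N, and $a_1+a_2\in\mathcal T\cup\mathcal A_0$ for all $a_1,a_2\in\mathcal T$. The height $m_c$ of $c\in\mathcal A$ is the minimal $t$ such that $c$ is a sum of $t$ elements of $\mathcal T$; $0$ has height $0$. For $k\in\mathbb N$, $kb$ denotes $b+\dots+b$ ($k$ times).
   Formalization: In case (i) the threshold m_0 may also be infinite (then A_0 consists of the elements of even height); with only finite m_0 the claim fails for A = N, T = {1}, 1^† = 1, A_0 = 2N. *)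

theory Defs
  imports Main "HOL-Library.Extended_Nat"
begin

text \<open>The additive semigroup with zero \<open>(\<A>, +, 0)\<close> is a whole type of class
  \<^class>\<open>comm_monoid_add\<close>. No multiplication on \<open>\<T>\<close> is assumed: \<open>\<T>\<close> is merely a set with a
  distinguished element, so the actions are not required to be associative.\<close>

locale T_left_module =
  fixes T :: "'t set" and one :: 't
    and lact :: "'t \<Rightarrow> 'a::comm_monoid_add \<Rightarrow> 'a" (infixr "\<cdot>" 70)
  assumes one_in_T: "one \<in> T"
    and lact_zero: "a \<in> T \<Longrightarrow> a \<cdot> 0 = 0"
    and lact_add: "a \<in> T \<Longrightarrow> a \<cdot> (b1 + b2) = a \<cdot> b1 + a \<cdot> b2"
    and lact_one: "one \<cdot> b = b"

locale T_right_module =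
  fixes T :: "'t set" and one :: 't
    and ract :: "'a::comm_monoid_add \<Rightarrow> 't \<Rightarrow> 'a" (infixl "\<odot>" 70)
  assumes one_in_T': "one \<in> T"
    and ract_zero: "a \<in> T \<Longrightarrow> 0 \<odot> a = 0"
    and ract_add: "a \<in> T \<Longrightarrow> (b1 + b2) \<odot> a = b1 \<odot> a + b2 \<odot> a"
    and ract_one: "b \<odot> one = b"

locale T_bimodule =
  T_left_module T one lact + T_right_module T one ract
  for T :: "'t set" and one :: 't
    and lact :: "'t \<Rightarrow> 'a::comm_monoid_add \<Rightarrow> 'a" (infixr "\<cdot>" 70)
    and ract :: "'a \<Rightarrow> 't \<Rightarrow> 'a" (infixl "\<odot>" 70) +
  assumes bimodule: "a1 \<in> T \<Longrightarrow> a2 \<in> T \<Longrightarrow> (a1 \<cdot> b) \<odot> a2 = a1 \<cdot> (b \<odot> a2)"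

text \<open>The inclusion of \<open>\<T>\<^sub>0 = \<T> \<union> {0}\<close> in \<open>\<A>\<close> is expressed by taking \<open>T\<close> to be a set of
  elements of the module type itself.\<close>

locale weakly_admissible =
  T_bimodule T one lact ract
  for T :: "'a::comm_monoid_add set" and one :: 'a
    and lact :: "'a \<Rightarrow> 'a \<Rightarrow> 'a" (infixr "\<cdot>" 70)
    and ract :: "'a \<Rightarrow> 'a \<Rightarrow> 'a" (infixl "\<odot>" 70) +
  assumes zero_notin_T: "0 \<notin> T"
    and lact_on_one: "a \<in> T \<Longrightarrow> a \<cdot> one = a"
    and ract_on_one: "a \<in> T \<Longrightarrow> one \<odot> a = a"

text \<open>The last four assumptions are the standing ones imposed on all pairs.\<close>

locale weakly_admissible_pair =
  weakly_admissible T one lact ract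
  for T :: "'a::comm_monoid_add set" and one :: 'a
    and lact :: "'a \<Rightarrow> 'a \<Rightarrow> 'a" (infixr "\<cdot>" 70)
    and ract :: "'a \<Rightarrow> 'a \<Rightarrow> 'a" (infixl "\<odot>" 70) +
  fixes A0 :: "'a set"
  assumes A0_zero: "0 \<in> A0"
    and A0_add: "b1 \<in> A0 \<Longrightarrow> b2 \<in> A0 \<Longrightarrow> b1 + b2 \<in> A0"
    and A0_lact: "a \<in> T \<Longrightarrow> b \<in> A0 \<Longrightarrow> a \<cdot> b \<in> A0"
    and A0_ract: "a \<in> T \<Longrightarrow> b \<in> A0 \<Longrightarrow> b \<odot> a \<in> A0"
    and A0_Int_T0: "A0 \<inter> (T \<union> {0}) = {0}"
    and lact_reflects_A0: "a \<in> T \<Longrightarrow> a \<cdot> b \<in> A0 \<Longrightarrow> b \<in> A0"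
    and ract_reflects_A0: "a \<in> T \<Longrightarrow> b \<odot> a \<in> A0 \<Longrightarrow> b \<in> A0"
    and lact_cancel: "a \<in> T \<Longrightarrow> a \<cdot> b1 = a \<cdot> b2 \<Longrightarrow> b1 = b2"
    and ract_cancel: "a \<in> T \<Longrightarrow> b1 \<odot> a = b2 \<odot> a \<Longrightarrow> b1 = b2"

locale admissible_pair =
  weakly_admissible_pair T one lact ract A0
  for T :: "'a::comm_monoid_add set" and one :: 'a
    and lact :: "'a \<Rightarrow> 'a \<Rightarrow> 'a" (infixr "\<cdot>" 70)
    and ract :: "'a \<Rightarrow> 'a \<Rightarrow> 'a" (infixl "\<odot>" 70)
    and A0 :: "'a set" +
  assumes T0_spans: "\<exists>xs. set xs \<subseteq> T \<union> {0} \<and> sum_list xs = b"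

definition first_kind :: "'a::comm_monoid_add \<Rightarrow> 'a set \<Rightarrow> bool" where
  "first_kind one A0 \<longleftrightarrow> one + one \<in> A0"

definition second_kind :: "'a::comm_monoid_add set \<Rightarrow> 'a set \<Rightarrow> bool" where
  "second_kind T A0 \<longleftrightarrow> (\<forall>a\<in>T. a + a \<notin> A0)"

text \<open>\<open>circ ract one_dag b\<close> is \<open>b\<^sup>\<circ> = b + b\<^sup>\<dagger>\<close> with \<open>b\<^sup>\<dagger> = b 1\<^sup>\<dagger>\<close>.\<close>

definition circ :: "('a \<Rightarrow> 't \<Rightarrow> 'a) \<Rightarrow> 't \<Rightarrow> 'a \<Rightarrow> 'a::comm_monoid_add" where
  "circ ract one_dag b = b + ract b one_dag"

text \<open>The element \<open>1\<^sup>\<dagger>\<close> is a parameter of the locale, i.e. fixed once and for all.\<close>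

locale weak_property_N =
  weakly_admissible_pair T one lact ract A0
  for T :: "'a::comm_monoid_add set" and one :: 'a
    and lact :: "'a \<Rightarrow> 'a \<Rightarrow> 'a" (infixr "\<cdot>" 70)
    and ract :: "'a \<Rightarrow> 'a \<Rightarrow> 'a" (infixl "\<odot>" 70)
    and A0 :: "'a set" +
  fixes one_dag :: 'a
  assumes one_dag_in_T: "one_dag \<in> T"
    and one_dag_A0: "one + one_dag \<in> A0"
    and one_dag_T: "a \<in> T \<Longrightarrow> one_dag \<cdot> a \<in> T"
    and one_dag_commute: "one_dag \<cdot> b = b \<odot> one_dag"

locale property_N =
  weak_property_N T one lact ract A0 one_dag
  for T :: "'a::comm_monoid_add set" and one :: 'a
    and lact :: "'a \<Rightarrow> 'a \<Rightarrow> 'a" (infixr "\<cdot>" 70)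
    and ract :: "'a \<Rightarrow> 'a \<Rightarrow> 'a" (infixl "\<odot>" 70)
    and A0 :: "'a set" and one_dag :: 'a +
  assumes add_eq_circ:
    "a1 \<in> T \<Longrightarrow> a2 \<in> T \<Longrightarrow> a1 + a2 \<in> A0 \<Longrightarrow> a1 + a2 = circ ract one_dag a1"

locale metatangible_pair =
  admissible_pair T one lact ract A0 + property_N T one lact ract A0 one_dag
  for T :: "'a::comm_monoid_add set" and one :: 'a
    and lact :: "'a \<Rightarrow> 'a \<Rightarrow> 'a" (infixr "\<cdot>" 70)
    and ract :: "'a \<Rightarrow> 'a \<Rightarrow> 'a" (infixl "\<odot>" 70)
    and A0 :: "'a set" and one_dag :: 'a +
  assumes metatangible: "a1 \<in> T \<Longrightarrow> a2 \<in> T \<Longrightarrow> a1 + a2 \<in> T \<union> A0"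

text \<open>The empty list is allowed, so \<open>height T 0 = 0\<close>. When \<open>T \<union> {0}\<close> spans, the minimum is over
  a nonempty set.\<close>

definition height :: "'a::comm_monoid_add set \<Rightarrow> 'a \<Rightarrow> nat" where
  "height T c = (LEAST t. \<exists>xs. length xs = t \<and> set xs \<subseteq> T \<and> sum_list xs = c)"

definition nmult :: "nat \<Rightarrow> 'a::comm_monoid_add \<Rightarrow> 'a" where
  "nmult k b = (\<Sum>i<k. b)"

text \<open>For a pair of the first kind, \<open>\<A>\<^sub>0\<close> is described by a threshold \<open>m\<^sub>0\<close> on the height.
  The threshold is an \<^typ>\<open>enat\<close> because it may be infinite: \<open>\<A> = \<nat>\<close> with \<open>\<T> = {1}\<close>, \<open>1\<^sup>\<dagger> = 1\<close> and
  \<open>\<A>\<^sub>0 = 2\<nat>\<close> is a metatangible pair of the first kind in which no element of odd height lies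
  in \<open>\<A>\<^sub>0\<close>.\<close>

definition height_threshold_set :: "'a::comm_monoid_add set \<Rightarrow> enat \<Rightarrow> 'a set" where
  "height_threshold_set T m0 =
    {nmult (height T c) cT | c cT. cT \<in> T \<and> c = nmult (height T c) cT \<and>
       (enat (height T c) \<ge> m0 \<or> even (height T c))}"

end

theory Submission
  imports Defs
begin

text \<open>
  Write an element \<open>c\<close> as a shortest sum of elements of \<open>\<T>\<close>. No two summands \<open>a\<close>, \<open>b\<close> may add up to
  an element of \<open>\<T>\<close>, as that would give a shorter sum; so metatangibility puts \<open>a + b\<close> in
  \<open>\<A>\<^sub>0\<close> (lemma \<open>add_in_A0_of_shortest\<close>), and Property N then says \<open>a + b = a\<^sup>\<circ>\<close>. Hence a shortest
  sum depends only on its length and on one of its summands, and everything follows from how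
  \<open>a + a\<close> behaves. Since \<open>a + a = a(1 + 1)\<close> and the action of \<open>a\<close> preserves and reflects \<open>\<A>\<^sub>0\<close>, it
  behaves in the same way for all \<open>a \<in> \<T>\<close>, so that the pair is of the first or of the second kind.

  In the first kind \<open>a\<^sup>\<circ> = a + a\<close>, so every summand \<open>b\<close> can be traded for \<open>a\<close> and \<open>c = m\<^sub>c a\<close>. Again
  by the action of \<open>a\<close>, whether \<open>k a\<close> lies in \<open>\<A>\<^sub>0\<close> depends on \<open>k\<close> only; even multiples always lie
  there, and therefore all multiples beyond the first odd one that does. This first odd multiple
  is the threshold, which is infinite when there is none.

  In the second kind \<open>a + a \<in> \<T>\<close>. A shortest sum \<open>a + b + c + \<dots>\<close> of length at least three would
  begin with \<open>a + b + c = a\<^sup>\<dagger> + (a + c) = a + (a\<^sup>\<dagger> + a\<^sup>\<dagger>)\<close>, a sum of two elements of \<open>\<T>\<close>; so all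
  heights are at most two, and an element of height two is some \<open>a\<^sup>\<circ>\<close>.
\<close>

section \<open>Multiples and heights\<close>

lemma nmult_0 [simp]: "nmult 0 b = 0"
  by (simp add: nmult_def)

lemma nmult_Suc [simp]: "nmult (Suc k) b = b + nmult k b"
  by (simp add: nmult_def add.commute)

lemma nmult_add: "nmult (k + l) b = nmult k b + nmult l b"
  by (induction k) (simp_all add: add.assoc)

lemma add_sum_list_eq_nmult:
  fixes a :: "'a::comm_monoid_add"
  assumes "\<And>b. b \<in> set ys \<Longrightarrow> a + b = a + a"
  shows "a + sum_list ys = nmult (Suc (length ys)) a"
  using assms
proof (induction ys)
  case (Cons b ys)
  have "a + sum_list (b # ys) = b + (a + sum_list ys)"
    by (simp add: ac_simps)
  also have "\<dots> = (a + b) + nmult (length ys) a"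
    using Cons by (simp add: ac_simps)
  also have "\<dots> = nmult (Suc (length (b # ys))) a"
    using Cons.prems[of b] by (simp add: add.assoc)
  finally show ?case .
qed simp

lemma height_sum_list_le: "set xs \<subseteq> T \<Longrightarrow> height T (sum_list xs) \<le> length xs"
  unfolding height_def by (rule Least_le) blast

lemma (in admissible_pair) ex_shortest_sum:
  obtains xs where "length xs = height T c" "set xs \<subseteq> T" "sum_list xs = c"
proof -
  obtain ys where ys: "set ys \<subseteq> T \<union> {0}" "sum_list ys = c"
    using T0_spans by blast
  have "sum_list (filter (\<lambda>x. x \<noteq> 0) ys) = sum_list ys"
    by (induction ys) auto
  moreover have "set (filter (\<lambda>x. x \<noteq> 0) ys) \<subseteq> T"
    using ys(1) by auto
  ultimately have "\<exists>t xs. length xs = t \<and> set xs \<subseteq> T \<and> sum_list xs = c"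
    using ys(2) by metis
  then have "\<exists>xs. length xs = height T c \<and> set xs \<subseteq> T \<and> sum_list xs = c"
    unfolding height_def by (rule LeastI_ex)
  then show thesis
    using that by blast
qed

section \<open>Multiples and sums of elements of \<open>\<T>\<close> in \<open>\<A>\<^sub>0\<close>\<close>

lemma (in weakly_admissible_pair) lact_nmult: "a \<in> T \<Longrightarrow> a \<cdot> nmult k b = nmult k (a \<cdot> b)"
  by (induction k) (simp_all add: lact_zero lact_add)

text \<open>Acting by \<open>a\<close> carries \<open>k 1\<close> to \<open>k a\<close>, and the action both preserves and reflects \<open>\<A>\<^sub>0\<close>; so
  membership of a multiple in \<open>\<A>\<^sub>0\<close> is decided by the multiplicity.\<close>

lemma (in weakly_admissible_pair) nmult_in_A0_iff:
  assumes "a \<in> T"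
  shows "nmult k a \<in> A0 \<longleftrightarrow> nmult k one \<in> A0"
proof -
  have "a \<cdot> nmult k one = nmult k a"
    using assms by (simp add: lact_nmult lact_on_one)
  then show ?thesis
    using assms A0_lact lact_reflects_A0 by metis
qed

lemma (in weakly_admissible_pair) double_in_A0_iff:
  assumes "a \<in> T"
  shows "a + a \<in> A0 \<longleftrightarrow> first_kind one A0"
  using nmult_in_A0_iff[OF assms, of 2] by (simp add: first_kind_def numeral_2_eq_2)

lemma (in weakly_admissible_pair) second_kind_iff_not_first_kind:
  "second_kind T A0 \<longleftrightarrow> \<not> first_kind one A0"
  using double_in_A0_iff one_in_T unfolding second_kind_def by blast

text \<open>As \<open>a\<^sup>\<dagger> = (a 1) 1\<^sup>\<dagger> = a (1 1\<^sup>\<dagger>)\<close>, one has \<open>a\<^sup>\<circ> = a (1 + 1\<^sup>\<dagger>)\<close>, a multiple of an element of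
  \<open>\<A>\<^sub>0\<close>.\<close>

lemma (in weak_property_N) circ_in_A0:
  assumes "a \<in> T"
  shows "circ ract one_dag a \<in> A0"
proof -
  have "a \<odot> one_dag = (a \<cdot> one) \<odot> one_dag"
    using assms by (simp add: lact_on_one)
  also have "\<dots> = a \<cdot> one_dag"
    using assms one_dag_in_T by (simp add: bimodule ract_on_one)
  finally have "circ ract one_dag a = a \<cdot> (one + one_dag)"
    using assms by (simp add: circ_def lact_add lact_on_one)
  then show ?thesis
    using assms A0_lact one_dag_A0 by simp
qed

lemma (in weak_property_N) dag_in_T: "a \<in> T \<Longrightarrow> a \<odot> one_dag \<in> T"
  using one_dag_T one_dag_commute by metis

text \<open>The heart of the proof: two summands with sum in \<open>\<T>\<close> could be merged into one.\<close>

lemma (in metatangible_pair) add_in_A0_of_shortest: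
  assumes xs: "set (a # ys) \<subseteq> T" "length (a # ys) = height T (sum_list (a # ys))"
    and b: "b \<in> set ys"
  shows "a + b \<in> A0"
proof (rule ccontr)
  assume "a + b \<notin> A0"
  then have ab: "a + b \<in> T"
    using metatangible[of a b] xs(1) b by auto
  obtain us vs where ys: "ys = us @ b # vs"
    using b by (meson split_list)
  have "set ((a + b) # us @ vs) \<subseteq> T"
    using ab xs(1) ys by auto
  moreover have "sum_list ((a + b) # us @ vs) = sum_list (a # ys)"
    by (simp add: ys ac_simps)
  ultimately have "height T (sum_list (a # ys)) \<le> length ((a + b) # us @ vs)"
    using height_sum_list_le by metis
  then show False
    using xs(2) ys by simp
qed

section \<open>Pairs of the first kind\<close>

context metatangible_pair
begin

text \<open>Property N determines a sum in \<open>\<A>\<^sub>0\<close> of two elements of \<open>\<T>\<close> from one summand, so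
  in a shortest sum every summand \<open>b\<close> may be replaced by the first one, \<open>a\<close>.\<close>

lemma first_kind_uniform_presentation:
  assumes "first_kind one A0"
  shows "\<exists>a\<in>T. c = nmult (height T c) a"
proof -
  obtain xs where xs: "length xs = height T c" "set xs \<subseteq> T" "sum_list xs = c"
    by (rule ex_shortest_sum)
  show ?thesis
  proof (cases xs)
    case Nil
    then show ?thesis
      using xs one_in_T by auto
  next
    case (Cons a ys)
    have a: "a \<in> T"
      using xs Cons by simp
    have "a + b = a + a" if "b \<in> set ys" for b
    proof -
      have "a + b \<in> A0"
        using add_in_A0_of_shortest[of a ys b] xs Cons that by simp
      \<comment> \<open>Both sums lie in \<open>\<A>\<^sub>0\<close>, so by Property N both are \<open>a\<^sup>\<circ>\<close>.\<close>
      moreover have "a + a \<in> A0"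
        using double_in_A0_iff a assms by simp
      moreover have "b \<in> T"
        using xs Cons that by auto
      ultimately show ?thesis
        using add_eq_circ a by metis
    qed
    then have "a + sum_list ys = nmult (Suc (length ys)) a"
      by (rule add_sum_list_eq_nmult)
    moreover have "c = a + sum_list ys" "height T c = Suc (length ys)"
      using xs Cons by simp_all
    ultimately have "c = nmult (height T c) a"
      by simp
    then show ?thesis
      using a by blast
  qed
qed

lemma even_nmult_in_A0:
  assumes "first_kind one A0" "even k"
  shows "nmult k one \<in> A0"
proof -
  obtain l where "k = l + l"
    using \<open>even k\<close> by (auto elim: evenE simp: mult_2)
  moreover have "nmult (l + l) one \<in> A0"
  proof (induction l)
    case (Suc l)
    have "nmult (Suc l + Suc l) one = (one + one) + nmult (l + l) one"
      by (simp add: ac_simps)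
    then show ?case
      using Suc assms(1) A0_add by (simp only: first_kind_def)
  qed (simp add: A0_zero)
  ultimately show ?thesis
    by simp
qed

text \<open>The multiplicity \<open>k\<close> has to be odd: otherwise \<open>k = 0\<close> would put \<open>1\<close> into \<open>\<A>\<^sub>0\<close>.\<close>

lemma nmult_in_A0_mono:
  assumes "first_kind one A0" "nmult k one \<in> A0" "odd k" "k \<le> n"
  shows "nmult n one \<in> A0"
proof (cases "even n")
  case True
  then show ?thesis
    using even_nmult_in_A0 assms(1) by blast
next
  case False
  \<comment> \<open>Two odd numbers differ by an even one.\<close>
  have "nmult n one = nmult k one + nmult (n - k) one"
    using nmult_add[of k "n - k" one] assms(4) by simp
  moreover have "even (n - k)"
    using False assms(3,4) by simp
  ultimately show ?thesis
    using assms(1,2) even_nmult_in_A0 A0_add by simp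
qed

lemma first_kind_ex_threshold:
  assumes "first_kind one A0"
  shows "\<exists>m0::enat. \<forall>n. nmult n one \<in> A0 \<longleftrightarrow> enat n \<ge> m0 \<or> even n"
proof (cases "\<exists>k. odd k \<and> nmult k one \<in> A0")
  case True
  define k where "k = (LEAST k. odd k \<and> nmult k one \<in> A0)"
  have k: "odd k \<and> nmult k one \<in> A0"
    unfolding k_def using True by (rule LeastI_ex)
  have "k \<le> n" if "odd n" "nmult n one \<in> A0" for n
    unfolding k_def using that by (intro Least_le conjI)
  then have "nmult n one \<in> A0 \<longleftrightarrow> k \<le> n \<or> even n" for n
    using k nmult_in_A0_mono even_nmult_in_A0 assms by blast
  then show ?thesis
    by (intro exI[of _ "enat k"]) simp
next
  case False
  then show ?thesis
    using even_nmult_in_A0 assms by (intro exI[of _ \<infinity>]) auto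
qed

lemma first_kind_A0_eq_height_threshold_set:
  assumes "first_kind one A0"
  shows "\<exists>m0. A0 = height_threshold_set T m0"
proof -
  obtain m0 where m0: "\<And>n. nmult n one \<in> A0 \<longleftrightarrow> enat n \<ge> m0 \<or> even n"
    using first_kind_ex_threshold[OF assms] by blast
  have iff: "c \<in> A0 \<longleftrightarrow> enat (height T c) \<ge> m0 \<or> even (height T c)"
    if "a \<in> T" "c = nmult (height T c) a" for a c
    using nmult_in_A0_iff[OF that(1), of "height T c"] that(2) m0 by simp
  have "c \<in> A0 \<longleftrightarrow> c \<in> height_threshold_set T m0" for c
  proof
    assume "c \<in> A0"
    then show "c \<in> height_threshold_set T m0"
      using first_kind_uniform_presentation[OF assms, of c] iff
      unfolding height_threshold_set_def by blast
  next
    assume "c \<in> height_threshold_set T m0"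
    then obtain d a where "c = nmult (height T d) a" "a \<in> T" "d = nmult (height T d) a"
      "enat (height T d) \<ge> m0 \<or> even (height T d)"
      unfolding height_threshold_set_def by blast
    then show "c \<in> A0"
      using iff[of a d] by simp
  qed
  then show ?thesis
    by blast
qed

section \<open>Pairs of the second kind\<close>

lemma second_kind_double_in_T: "second_kind T A0 \<Longrightarrow> a \<in> T \<Longrightarrow> a + a \<in> T"
  using metatangible[of a a] unfolding second_kind_def by auto

lemma second_kind_uniform_presentation:
  assumes "second_kind T A0"
  shows "\<exists>a\<in>T. (c = 0 \<and> height T c = 0) \<or> (c = a \<and> height T c = 1) \<or>
    (c = circ ract one_dag a \<and> height T c = 2)"
proof -
  obtain xs where xs: "length xs = height T c" "set xs \<subseteq> T" "sum_list xs = c"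
    by (rule ex_shortest_sum)
  have add_eq: "a + b = circ ract one_dag a" if "xs = a # ys" "b \<in> set ys" for a b ys
    using add_in_A0_of_shortest[of a ys b] add_eq_circ[of a b] xs that by auto
  consider "xs = []" | a where "xs = [a]" | a b where "xs = [a, b]"
    | a b d zs where "xs = a # b # d # zs"
    by (metis list.exhaust)
  then show ?thesis
  proof cases
    case 1
    then show ?thesis
      using xs one_in_T by auto
  next
    case (2 a)
    then show ?thesis
      using xs by auto
  next
    case (3 a b)
    then have "c = circ ract one_dag a"
      using add_eq[of a "[b]" b] xs(3) by simp
    moreover have "a \<in> T" "height T c = 2"
      using xs 3 by auto
    ultimately show ?thesis
      by blast
  next
    case (4 a b d zs)
    \<comment> \<open>Trade \<open>a + b\<close> and \<open>a + d\<close> in turn for \<open>a\<^sup>\<circ>\<close>: the three summands become \<open>a\<close> and \<open>a\<^sup>\<dagger> + a\<^sup>\<dagger>\<close>,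
      and the latter lies in \<open>\<T>\<close>. The sum was not a shortest one.\<close>
    let ?a' = "a \<odot> one_dag"
    have a: "a \<in> T"
      using xs 4 by simp
    have "sum_list (a # (?a' + ?a') # zs) = ?a' + (a + ?a') + sum_list zs"
      by (simp add: ac_simps)
    also have "\<dots> = ?a' + (a + d) + sum_list zs"
      using add_eq[of a "b # d # zs" d] 4 by (simp add: circ_def)
    also have "\<dots> = (a + ?a') + d + sum_list zs"
      by (simp add: ac_simps)
    also have "\<dots> = (a + b) + d + sum_list zs"
      using add_eq[of a "b # d # zs" b] 4 by (simp add: circ_def)
    also have "\<dots> = c"
      using xs 4 by (simp add: ac_simps)
    finally have "sum_list (a # (?a' + ?a') # zs) = c" .
    moreover have "set (a # (?a' + ?a') # zs) \<subseteq> T"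
      using a xs 4 second_kind_double_in_T[OF assms dag_in_T] by simp
    ultimately have "height T c \<le> length (a # (?a' + ?a') # zs)"
      using height_sum_list_le by metis
    then show ?thesis
      using xs(1) 4 by simp
  qed
qed

lemma second_kind_UNIV_eq:
  assumes "second_kind T A0"
  shows "UNIV = {0} \<union> T \<union> circ ract one_dag ` T"
  using second_kind_uniform_presentation[OF assms] by blast

lemma second_kind_A0_eq:
  assumes "second_kind T A0"
  shows "A0 = circ ract one_dag ` T \<union> {0}"
proof
  show "A0 \<subseteq> circ ract one_dag ` T \<union> {0}"
    using second_kind_UNIV_eq[OF assms] A0_Int_T0 by blast
  show "circ ract one_dag ` T \<union> {0} \<subseteq> A0"
    using circ_in_A0 A0_zero by blast
qed

end

section \<open>The uniform presentation\<close>

theorem theorem1: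
  fixes T A0 :: "'a::comm_monoid_add set" and one one_dag :: 'a
    and lact ract :: "'a \<Rightarrow> 'a \<Rightarrow> 'a"
  assumes "metatangible_pair T one lact ract A0 one_dag"
  shows "(\<forall>c. \<exists>cT\<in>T.
            (first_kind one A0 \<and> c = nmult (height T c) cT) \<or>
            (second_kind T A0 \<and>
              ((c = 0 \<and> height T c = 0) \<or>
               (c = cT \<and> height T c = 1) \<or>
               (c = circ ract one_dag cT \<and> height T c = 2)))) \<and>
         (first_kind one A0 \<longrightarrow> (\<exists>m0::enat. A0 = height_threshold_set T m0)) \<and>
         (second_kind T A0 \<longrightarrow>
            UNIV = {0} \<union> T \<union> circ ract one_dag ` T \<and>
            A0 = circ ract one_dag ` T \<union> {0})"
proof -
  interpret metatangible_pair T one lact ract A0 one_dag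
    by (fact assms)
  show ?thesis
  proof (intro conjI impI allI)
    fix c
    show "\<exists>cT\<in>T.
            (first_kind one A0 \<and> c = nmult (height T c) cT) \<or>
            (second_kind T A0 \<and>
              ((c = 0 \<and> height T c = 0) \<or>
               (c = cT \<and> height T c = 1) \<or>
               (c = circ ract one_dag cT \<and> height T c = 2)))"
    proof (cases "first_kind one A0")
      case True
      then show ?thesis
        using first_kind_uniform_presentation[OF True, of c] by blast
    next
      case False
      then have "second_kind T A0"
        by (simp add: second_kind_iff_not_first_kind)
      then show ?thesis
        using second_kind_uniform_presentation[of c] by blast
    qed
  qed (fact first_kind_A0_eq_height_threshold_set second_kind_UNIV_eq second_kind_A0_eq)+
qed

end
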